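(* Let $g(p)$ denote the length of the shortest squarefree word over a ternary alphabet having exactly $p$ nontrivial periods. Then for every $p\ge3$, $g(p) \leq \frac{17}{12}4^{p-1} + \frac13$.
   Context: A square is a nonempty word of the form $xx$; a word is squarefree if none of its factors is a square. For a finite nonempty word $w$, an integer $p$ with $1\le p\le|w|$ is a period if $w[i]=w[i+p]$ for $1\le i\le |w|-p$; it is nontrivial if $p<|w|$. *)

theory Defs
  imports Complex_Main "HOL-Library.Sublist"
begin

definition square_word :: "'a list \<Rightarrow> bool" where
  "square_word w \<longleftrightarrow> (\<exists>x. x \<noteq> [] \<and> w = x @ x)"

text \<open>Factors are contiguous, i.e. they are the sublists in the sense of \<^const>\<open>sublist\<close>.\<close>

definition squarefree_word :: "'a list \<Rightarrow> bool" where
  "squarefree_word w \<longleftrightarrow> (\<forall>u. sublist u w \<longrightarrow> \<not> square_word u)"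

text \<open>Positions are counted from 0, so the range of \<open>i\<close> is \<open>0 \<le> i < |w| - p\<close>.\<close>

definition is_period :: "'a list \<Rightarrow> nat \<Rightarrow> bool" where
  "is_period w p \<longleftrightarrow> 1 \<le> p \<and> p \<le> length w \<and> (\<forall>i. i + p < length w \<longrightarrow> w ! i = w ! (i + p))"

definition nontrivial_periods :: "'a list \<Rightarrow> nat set" where
  "nontrivial_periods w = {p. is_period w p \<and> p < length w}"

definition squarefree_words_with_periods :: "'a set \<Rightarrow> nat \<Rightarrow> 'a list set" where
  "squarefree_words_with_periods A p =
     {w. w \<noteq> [] \<and> w \<in> lists A \<and> squarefree_word w \<and> card (nontrivial_periods w) = p}"

text \<open>The value is meaningful only if \<open>squarefree_words_with_periods A p\<close> is nonempty, as
  \<open>Least\<close> is otherwise unspecified.\<close>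

definition g :: "'a set \<Rightarrow> nat \<Rightarrow> nat" where
  "g A p = (LEAST n. \<exists>w \<in> squarefree_words_with_periods A p. length w = n)"

end

theory Submission
  imports Defs
begin

text \<open>
  Nontrivial periods of \<open>w\<close> correspond to its borders. The longest border of \<open>w\<close> has exactly one
  border fewer than \<open>w\<close>, so it suffices to find short squarefree words with at least \<open>p\<close> borders.
  Leech's 13-uniform morphism preserves squarefreeness: windows of length 8 in an image determine
  their position modulo 13, so the period of a long square is a multiple of 13, and reading off
  the last letter of each block yields a square in the preimage. The image of a word that begins
  and ends with the same letter \<open>a\<close> has all images of the old borders as borders, and the
  two borders (of lengths 1 and 5) of the image of \<open>a\<close> in addition. Since \<open>13 < 4\<^sup>2\<close>, the bound for
  \<open>p\<close> implies the one for \<open>p + 2\<close>, and the induction starts from a word of length 23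
  with 3 borders and the image of \<open>abacaba\<close>, which has length 91 and 4 borders.
\<close>

section \<open>Squares and borders\<close>

text \<open>Squares are located by start and half-length, so that positions in an image can be
  compared modulo 13.\<close>

definition square_at :: "'a list \<Rightarrow> nat \<Rightarrow> nat \<Rightarrow> bool" where
  "square_at w i m \<longleftrightarrow> 0 < m \<and> i + 2 * m \<le> length w \<and> (\<forall>j<m. w ! (i + j) = w ! (i + m + j))"

lemma square_at_iff_take:
  "square_at w i m \<longleftrightarrow>
     0 < m \<and> i + 2 * m \<le> length w \<and> take m (drop i w) = take m (drop (i + m) w)"
  by (auto simp: square_at_def list_eq_iff_nth_eq)

lemma squarefree_word_iff_square_at: "squarefree_word w \<longleftrightarrow> (\<forall>i m. \<not> square_at w i m)"
proof
  assume sf: "squarefree_word w"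
  show "\<forall>i m. \<not> square_at w i m"
  proof (intro allI notI)
    fix i m
    assume sq: "square_at w i m"
    define x where "x = take m (drop i w)"
    have "take (2 * m) (drop i w) = x @ take m (drop m (drop i w))"
      unfolding x_def mult_2 by (rule take_add)
    also have "\<dots> = x @ x"
      using sq by (simp add: square_at_iff_take x_def add.commute)
    finally have "take (2 * m) (drop i w) = x @ x" .
    moreover have "x \<noteq> []"
      using sq by (auto simp: x_def square_at_def)
    ultimately have "square_word (take (2 * m) (drop i w))"
      unfolding square_word_def by blast
    moreover have "sublist (take (2 * m) (drop i w)) w"
      by (meson sublist_drop sublist_order.order.trans sublist_take)
    ultimately show False
      using sf unfolding squarefree_word_def by blast
  qed
next
  assume no: "\<forall>i m. \<not> square_at w i m"
  show "squarefree_word w"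
    unfolding squarefree_word_def square_word_def
  proof (intro allI impI notI)
    fix u
    assume "sublist u w" and "\<exists>x. x \<noteq> [] \<and> u = x @ x"
    then obtain x ps ss where "x \<noteq> []" and w: "w = ps @ x @ x @ ss"
      by (auto simp: sublist_def)
    then have "square_at w (length ps) (length x)"
      by (simp add: square_at_iff_take)
    then show False
      using no by blast
  qed
qed

lemma squarefree_word_if_list_all:
  assumes "list_all (\<lambda>i. list_all (\<lambda>m. i + 2 * m \<le> length w \<longrightarrow>
    take m (drop i w) \<noteq> take m (drop (i + m) w)) [1..<length w]) [0..<length w]"
  shows "squarefree_word w"
  unfolding squarefree_word_iff_square_at
proof (intro allI notI)
  fix i m
  assume "square_at w i m"
  then have "0 < m" "i + 2 * m \<le> length w" "take m (drop i w) = take m (drop (i + m) w)"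
    by (simp_all add: square_at_iff_take)
  moreover from this have "i \<in> set [0..<length w]" "m \<in> set [1..<length w]"
    by auto
  ultimately show False
    using assms unfolding list_all_iff by blast
qed

lemma squarefree_word_sublist: "squarefree_word w \<Longrightarrow> sublist v w \<Longrightarrow> squarefree_word v"
  unfolding squarefree_word_def by (meson sublist_order.order.trans)

lemma squarefree_word_map_inj:
  assumes "inj f" and "squarefree_word w"
  shows "squarefree_word (map f w)"
proof -
  have "square_at (map f w) i m \<longleftrightarrow> square_at w i m" for i m
    using assms(1) by (auto simp: square_at_def inj_eq)
  then show ?thesis
    using assms(2) by (simp add: squarefree_word_iff_square_at)
qed

section \<open>Borders, periods and prefixes\<close>

definition borders :: "'a list \<Rightarrow> nat set" where
  "borders w = {k. 0 < k \<and> k < length w \<and> take k w = drop (length w - k) w}"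

lemma finite_borders: "finite (borders w)"
  by (rule finite_subset[of _ "{..<length w}"]) (auto simp: borders_def)

lemma borders_map_inj: "inj f \<Longrightarrow> borders (map f w) = borders w"
  by (simp add: borders_def take_map drop_map)

text \<open>The map k to |w| - k is its own inverse and exchanges border lengths and nontrivial
  periods.\<close>

lemma card_nontrivial_periods: "card (nontrivial_periods w) = card (borders w)"
proof -
  have per: "is_period w p \<longleftrightarrow> 1 \<le> p \<and> p \<le> length w \<and> take (length w - p) w = drop p w" for p
    by (auto simp: is_period_def list_eq_iff_nth_eq add.commute)
  have "bij_betw (\<lambda>k. length w - k) (borders w) (nontrivial_periods w)"
    by (rule bij_betw_byWitness[where f' = "\<lambda>k. length w - k"])
      (auto simp: borders_def nontrivial_periods_def per)
  then show ?thesis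
    by (simp add: bij_betw_same_card)
qed

text \<open>A border is also a suffix of \<open>w\<close>, so for j < k its last j letters are the
  last j letters of \<open>w\<close>.\<close>

lemma borders_take_border:
  assumes "k \<in> borders w"
  shows "borders (take k w) = {j \<in> borders w. j < k}"
proof -
  have k: "k < length w" "take k w = drop (length w - k) w"
    using assms by (auto simp: borders_def)
  have "drop (k - j) (take k w) = drop (length w - j) w" if "j < k" for j
    using k that by simp
  then show ?thesis
    using k(1) by (auto simp: borders_def min_def)
qed

lemma exists_prefix_with_card_borders:
  assumes "p \<le> card (borders w)" and "w \<noteq> []"
  shows "\<exists>v. prefix v w \<and> v \<noteq> [] \<and> card (borders v) = p"
  using assms
proof (induction "length w" arbitrary: w rule: less_induct)
  case less
  show ?case
  proof (cases "card (borders w) = p")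
    case True
    then show ?thesis
      using less.prems by blast
  next
    case False
    define k where "k = Max (borders w)"
    have "borders w \<noteq> {}"
      using False less.prems by auto
    then have k: "k \<in> borders w" and max: "\<And>j. j \<in> borders w \<Longrightarrow> j \<le> k"
      by (simp_all add: k_def finite_borders)
    \<comment> \<open>By maximality of \<open>k\<close> every other border is shorter and survives;
      each descent thus loses exactly one border and cannot skip \<open>p\<close>.\<close>
    then have "borders (take k w) = borders w - {k}"
      by (auto simp: borders_take_border le_less)
    then have "p \<le> card (borders (take k w))"
      using False less.prems k by (simp add: finite_borders)
    moreover have "length (take k w) < length w" "take k w \<noteq> []"
      using k by (auto simp: borders_def)
    ultimately obtain v where "prefix v (take k w)" "v \<noteq> []" "card (borders v) = p"
      using less.hyps by blast
    then show ?thesis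
      using prefix_order.trans take_is_prefix by blast
  qed
qed

section \<open>Leech's morphism\<close>

text \<open>A concrete alphabet makes the finite checks computable; the final theorem transports the
  word to \<open>A\<close>.\<close>

datatype letter = X | Y | Z

lemma letter_UNIV: "(UNIV :: letter set) = {X, Y, Z}"
  using letter.exhaust by blast

fun leech_block :: "letter \<Rightarrow> letter list" where
  "leech_block X = [X,Y,Z,Y,X,Z,Y,Z,X,Y,Z,Y,X]"
| "leech_block Y = [Y,Z,X,Z,Y,X,Z,X,Y,Z,X,Z,Y]"
| "leech_block Z = [Z,X,Y,X,Z,Y,X,Y,Z,X,Y,X,Z]"

definition leech :: "letter list \<Rightarrow> letter list" where
  "leech w = concat (map leech_block w)"

lemma length_leech_block [simp]: "length (leech_block a) = 13"
  by (cases a) simp_all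

lemma leech_block_last: "leech_block a ! 12 = a"
  by (cases a) simp_all

lemma leech_Nil [simp]: "leech [] = []"
  and leech_Cons [simp]: "leech (a # w) = leech_block a @ leech w"
  and leech_append [simp]: "leech (v @ w) = leech v @ leech w"
  by (simp_all add: leech_def)

lemma length_leech [simp]: "length (leech w) = 13 * length w"
  by (induction w) simp_all

lemma leech_nth:
  "i < 13 * length w \<Longrightarrow> leech w ! i = leech_block (w ! (i div 13)) ! (i mod 13)"
proof (induction w arbitrary: i)
  case (Cons a w)
  show ?case
  proof (cases "i < 13")
    case False
    then obtain j where "i = 13 + j"
      using le_Suc_ex not_less by blast
    then show ?thesis
      using Cons by (simp add: nth_append)
  qed (simp add: nth_append)
qed simp

text \<open>Up to 26 letters counted from the start of a block lie in two consecutive blocks.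
  Adjacent letters of a squarefree word differ, so local questions about images reduce to the six
  words in \<open>leech_pairs\<close>.\<close>

lemma leech_window:
  assumes sf: "squarefree_word w" and i: "i < 13 * length w"
  shows "\<exists>b. b \<noteq> w ! (i div 13) \<and>
    (\<forall>k. i mod 13 + k < 26 \<longrightarrow> i + k < 13 * length w \<longrightarrow>
      leech w ! (i + k) = (leech_block (w ! (i div 13)) @ leech_block b) ! (i mod 13 + k))"
proof -
  define s where "s = i div 13"
  \<comment> \<open>After the last block there is no next letter; any letter other than
    \<open>w ! s\<close> serves as a default.\<close>
  define b where "b = (if Suc s < length w then w ! Suc s else if w ! s = X then Y else X)"
  have "b \<noteq> w ! s"
  proof (cases "Suc s < length w")
    case True
    have "\<not> square_at w s 1"
      using sf by (simp add: squarefree_word_iff_square_at)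
    then show ?thesis
      using True by (auto simp: b_def square_at_def)
  qed (simp add: b_def)
  moreover have "leech w ! (i + k) = (leech_block (w ! s) @ leech_block b) ! (i mod 13 + k)"
    if k: "i mod 13 + k < 26" "i + k < 13 * length w" for k
  proof -
    have ik: "i + k = 13 * s + (i mod 13 + k)"
      by (simp add: s_def)
    show ?thesis
    proof (cases "i mod 13 + k < 13")
      case True
      then have "(i + k) div 13 = s" "(i + k) mod 13 = i mod 13 + k"
        unfolding ik by simp_all
      then show ?thesis
        using k(2) True by (simp add: leech_nth nth_append)
    next
      case False
      then obtain r where r: "i mod 13 + k = 13 + r"
        using le_Suc_ex not_less by blast
      then have "r < 13"
        using k(1) by simp
      moreover have "i + k = 13 * Suc s + r"
        using ik r by simp
      ultimately have "(i + k) div 13 = Suc s" "(i + k) mod 13 = r"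
        by (simp_all del: mult_Suc_right)
      moreover have "Suc s < length w"
        using \<open>i + k = 13 * Suc s + r\<close> k(2) by simp
      ultimately show ?thesis
        using k(2) r by (simp add: leech_nth nth_append b_def)
    qed
  qed
  ultimately show ?thesis
    unfolding s_def by blast
qed

section \<open>Finite checks and squarefreeness of images\<close>

definition leech_pairs :: "letter list list" where
  "leech_pairs = map (\<lambda>(a, b). leech_block a @ leech_block b)
     [(X, Y), (X, Z), (Y, X), (Y, Z), (Z, X), (Z, Y)]"

lemma leech_pairs_mem: "a \<noteq> b \<Longrightarrow> leech_block a @ leech_block b \<in> set leech_pairs"
  by (cases a; cases b) (simp_all add: leech_pairs_def)

definition positions_determined :: "(nat \<times> 'a list) list \<Rightarrow> bool" where
  "positions_determined xs \<longleftrightarrow>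
     list_all (\<lambda>(r, x). list_all (\<lambda>(s, y). x = y \<longrightarrow> r = s) xs) xs"

lemma leech_pairs_synchronizing_code:
  "positions_determined
     (concat (map (\<lambda>u. map (\<lambda>r. (r, take 8 (drop r u))) [0..<13]) leech_pairs))"
  by code_simp

lemma leech_pairs_synchronizing:
  assumes "u \<in> set leech_pairs" "v \<in> set leech_pairs" "r < 13" "s < 13"
    and "take 8 (drop r u) = take 8 (drop s v)"
  shows "r = s"
  using leech_pairs_synchronizing_code assms
  by (simp add: positions_determined_def list_all_iff)

text \<open>The ranges fit a pair exactly: a square with offset at most 12 and half-length at most 7
  ends by 12 + 2 * 7 = 26.\<close>

lemma leech_pairs_no_short_square_code:
  "list_all (\<lambda>u. list_all (\<lambda>r. list_all (\<lambda>m.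
     take m (drop r u) \<noteq> take m (drop (r + m) u)) [1..<8]) [0..<13]) leech_pairs"
  by (simp add: leech_pairs_def upt_rec)

lemma leech_pairs_no_short_square:
  assumes "u \<in> set leech_pairs" "r < 13" "0 < m" "m < 8"
  shows "take m (drop r u) \<noteq> take m (drop (r + m) u)"
  using leech_pairs_no_short_square_code assms unfolding list_all_iff by simp

theorem squarefree_word_leech:
  assumes sf: "squarefree_word w"
  shows "squarefree_word (leech w)"
  unfolding squarefree_word_iff_square_at
proof (intro allI notI)
  fix i m
  assume "square_at (leech w) i m"
  then have m: "0 < m" and le: "i + 2 * m \<le> 13 * length w"
    and eq: "\<And>j. j < m \<Longrightarrow> leech w ! (i + j) = leech w ! (i + m + j)"
    by (simp_all add: square_at_def)
  define a where "a = w ! (i div 13)"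
  obtain b where ab: "b \<noteq> a"
    and win: "\<And>k. i mod 13 + k < 26 \<Longrightarrow> i + k < 13 * length w \<Longrightarrow>
      leech w ! (i + k) = (leech_block a @ leech_block b) ! (i mod 13 + k)"
    using leech_window[OF sf, of i] m le unfolding a_def by auto
  have r: "i mod 13 < 13"
    by simp
  show False
  \<comment> \<open>Below 8 the whole square fits into one pair of blocks; from 8 on each half
    contains a window long enough to synchronize.\<close>
  proof (cases "m < 8")
    case True
    have "(leech_block a @ leech_block b) ! (i mod 13 + j)
        = (leech_block a @ leech_block b) ! (i mod 13 + m + j)" if "j < m" for j
      using win[of j] win[of "m + j"] eq[OF that] that True r le by (simp add: add.assoc)
    then have "take m (drop (i mod 13) (leech_block a @ leech_block b))
        = take m (drop (i mod 13 + m) (leech_block a @ leech_block b))"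
      using True r by (intro nth_equalityI) (auto simp del: drop_append)
    then show False
      using leech_pairs_no_short_square[OF leech_pairs_mem[OF ab[symmetric]] r m True]
      by contradiction
  next
    case False
    define c where "c = w ! ((i + m) div 13)"
    obtain d where cd: "d \<noteq> c"
      and win': "\<And>k. (i + m) mod 13 + k < 26 \<Longrightarrow> i + m + k < 13 * length w \<Longrightarrow>
        leech w ! (i + m + k) = (leech_block c @ leech_block d) ! ((i + m) mod 13 + k)"
      using leech_window[OF sf, of "i + m"] m le unfolding c_def by auto
    have r': "(i + m) mod 13 < 13"
      by simp
    have "(leech_block a @ leech_block b) ! (i mod 13 + j)
        = (leech_block c @ leech_block d) ! ((i + m) mod 13 + j)" if "j < 8" for j
      using win[of j] win'[of j] eq[of j] that False r r' le by simp
    then have "take 8 (drop (i mod 13) (leech_block a @ leech_block b))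
        = take 8 (drop ((i + m) mod 13) (leech_block c @ leech_block d))"
      using r r' by (intro nth_equalityI) (auto simp del: drop_append)
    then have "i mod 13 = (i + m) mod 13"
      by (rule leech_pairs_synchronizing[OF leech_pairs_mem[OF ab[symmetric]]
            leech_pairs_mem[OF cd[symmetric]] r r'])
    then have "13 dvd m"
      using mod_eq_dvd_iff_nat[of i "i + m" 13] by simp
    then obtain q where q: "m = 13 * q"
      by blast
    define s where "s = i div 13"
    have s: "13 * s \<le> i" "i \<le> 13 * s + 12"
      using div_mult_mod_eq[of i 13] r unfolding s_def by linarith+
    have last: "leech w ! (13 * t + 12) = w ! t" if "t < length w" for t
      using that by (simp add: leech_nth leech_block_last)
    have "w ! (s + j) = w ! (s + q + j)" if j: "j < q" for j
    proof -
      \<comment> \<open>The last letter of block \<open>s + j\<close> lies at distance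
        \<open>k\<close> from \<open>i\<close>. Last letters are read because block \<open>s\<close>
        may begin before \<open>i\<close>, whereas its last position 13 * s + 12 is never before
        \<open>i\<close>.\<close>
      define k where "k = 13 * (s + j) + 12 - i"
      have k: "i + k = 13 * (s + j) + 12" "i + m + k = 13 * (s + q + j) + 12" "k < m"
        using s j q by (auto simp: k_def)
      have "13 * (s + q + j) + 12 < 13 * length w"
        using k le by linarith
      then have "s + q + j < length w"
        by presburger
      then show ?thesis
        using eq[OF k(3)] last[of "s + j"] last[of "s + q + j"] by (simp add: k(1,2))
    qed
    moreover have "0 < q" "s + 2 * q \<le> length w"
      using m q s le by linarith+
    ultimately have "square_at w s q"
      by (simp add: square_at_def)
    then show False
      using sf by (simp add: squarefree_word_iff_square_at)
  qed
qed

section \<open>Borders of images\<close>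

lemma leech_take: "leech (take k w) = take (13 * k) (leech w)"
proof (cases "k \<le> length w")
  case True
  then show ?thesis
    by (metis append_eq_conv_conj append_take_drop_id leech_append length_leech length_take min.absorb2)
qed simp

lemma leech_drop: "leech (drop k w) = drop (13 * k) (leech w)"
proof (cases "k \<le> length w")
  case True
  then show ?thesis
    by (metis append_eq_conv_conj append_take_drop_id leech_append length_leech length_take min.absorb2)
qed simp

lemma borders_leech: "k \<in> borders w \<Longrightarrow> 13 * k \<in> borders (leech w)"
  unfolding borders_def
  by (auto simp: leech_take[symmetric] leech_drop[symmetric] diff_mult_distrib2[symmetric])

text \<open>The border of length 1 says that \<open>w\<close> begins and ends with the same letter;
  it reappears in the image, so the construction can be iterated.\<close>

lemma card_borders_leech:
  assumes "1 \<in> borders w"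
  shows "1 \<in> borders (leech w)" and "card (borders w) + 2 \<le> card (borders (leech w))"
proof -
  obtain a v where w: "w = a # v"
    using assms by (cases w) (auto simp: borders_def)
  have "13 \<in> borders (leech w)"
    using borders_leech[OF assms] by simp
  then have "borders (take 13 (leech w)) \<subseteq> borders (leech w)"
    by (auto simp: borders_take_border)
  moreover have "take 13 (leech w) = leech_block a"
    by (simp add: w)
  moreover have "{1, 5} \<subseteq> borders (leech_block a)"
    by (cases a) (simp_all add: borders_def)
  ultimately have new: "{1, 5} \<subseteq> borders (leech w)"
    by auto
  then show "1 \<in> borders (leech w)"
    by simp
  have "card (borders w) + 2 = card ((\<lambda>k. 13 * k) ` borders w) + card {1, 5 :: nat}"
    by (simp add: card_image inj_on_def)
  also have "\<dots> = card ((\<lambda>k. 13 * k) ` borders w \<union> {1, 5})"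
    \<comment> \<open>Neither 1 nor 5 is a multiple of 13.\<close>
    by (rule card_Un_disjoint[symmetric]) (auto simp: finite_borders, presburger+)
  also have "\<dots> \<le> card (borders (leech w))"
    using new borders_leech by (intro card_mono finite_borders) auto
  finally show "card (borders w) + 2 \<le> card (borders (leech w))" .
qed

section \<open>Short words with many borders\<close>

text \<open>The borders are nested: X, XYX and u = XYXZYZXYX, with w = u ZYXYZ u. Length 23 attains
  the bound for p = 3.\<close>

lemma squarefree_word_with_3_borders:
  fixes w :: "letter list"
  defines "w \<equiv> [X,Y,X,Z,Y,Z,X,Y,X,Z,Y,X,Y,Z,X,Y,X,Z,Y,Z,X,Y,X]"
  shows "squarefree_word w" and "{1, 3, 9} \<subseteq> borders w"
proof -
  show "squarefree_word w"
    unfolding w_def by (rule squarefree_word_if_list_all) code_simp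
  show "{1, 3, 9} \<subseteq> borders w"
    by (simp add: borders_def w_def)
qed

text \<open>Its image has length 91, which attains the bound for p = 4.\<close>

lemma squarefree_word_with_2_borders:
  fixes w :: "letter list"
  defines "w \<equiv> [X,Y,X,Z,X,Y,X]"
  shows "squarefree_word w" and "{1, 3} \<subseteq> borders w"
proof -
  show "squarefree_word w"
    unfolding w_def by (rule squarefree_word_if_list_all) code_simp
  show "{1, 3} \<subseteq> borders w"
    by (simp add: borders_def w_def)
qed

text \<open>The bound is multiplied by 12 to stay in the naturals. As the step raises
  \<open>p\<close> by 2, each parity needs its own base case.\<close>

lemma exists_squarefree_word_with_many_borders:
  assumes "3 \<le> p"
  shows "\<exists>w :: letter list. squarefree_word w \<and> 1 \<in> borders w \<and> p \<le> card (borders w) \<and>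
    12 * length w \<le> 17 * 4 ^ (p - 1) + 4"
  using assms
proof (induction p rule: less_induct)
  case (less p)
  consider "p = 3" | "p = 4" | "5 \<le> p"
    using less.prems by linarith
  then show ?case
  proof cases
    case 1
    have "3 \<le> card (borders [X,Y,X,Z,Y,Z,X,Y,X,Z,Y,X,Y,Z,X,Y,X,Z,Y,Z,X,Y,X])"
      using card_mono[OF finite_borders squarefree_word_with_3_borders(2)] by simp
    then show ?thesis
      using squarefree_word_with_3_borders 1
      by (intro exI[of _ "[X,Y,X,Z,Y,Z,X,Y,X,Z,Y,X,Y,Z,X,Y,X,Z,Y,Z,X,Y,X]"]) simp
  next
    case 2
    define w where "w = [X,Y,X,Z,X,Y,X]"
    have w: "squarefree_word w" "1 \<in> borders w" "length w = 7"
      using squarefree_word_with_2_borders by (simp_all add: w_def)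
    have "2 \<le> card (borders w)"
      using card_mono[OF finite_borders squarefree_word_with_2_borders(2)] by (simp add: w_def)
    then show ?thesis
      using w 2 card_borders_leech[OF w(2)] squarefree_word_leech[OF w(1)]
      by (intro exI[of _ "leech w"]) simp
  next
    case 3
    then have "p - 2 < p" "3 \<le> p - 2"
      by simp_all
    then obtain w :: "letter list" where w: "squarefree_word w" "1 \<in> borders w"
      "p - 2 \<le> card (borders w)" "12 * length w \<le> 17 * 4 ^ (p - 2 - 1) + 4"
      using less.IH by blast
    define x :: nat where "x = 4 ^ (p - 2 - 1)"
    have "p - 1 = p - 2 - 1 + 2"
      using 3 by simp
    then have "(4 :: nat) ^ (p - 1) = 16 * x"
      by (simp only: power_add x_def) simp
    \<comment> \<open>This gives 13 * (17 * x + 4) = 221 * x + 52 \<le> 272 * x + 4, since 48 \<le>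
      51 * x.\<close>
    moreover have "1 \<le> x"
      by (simp add: x_def)
    moreover have "12 * length w \<le> 17 * x + 4"
      using w(4) by (simp add: x_def)
    ultimately have "12 * length (leech w) \<le> 17 * 4 ^ (p - 1) + 4"
      by simp
    moreover have "p \<le> card (borders (leech w))"
      using w(3) card_borders_leech(2)[OF w(2)] by linarith
    ultimately show ?thesis
      using squarefree_word_leech[OF w(1)] card_borders_leech(1)[OF w(2)] by blast
  qed
qed

theorem theorem22:
  fixes A :: "'a set" and p :: nat
  assumes "card A = 3" and "p \<ge> 3"
  shows "squarefree_words_with_periods A p \<noteq> {} \<and>
         real (g A p) \<le> 17 / 12 * 4 ^ (p - 1) + 1 / 3"
proof -
  obtain w :: "letter list" where w: "squarefree_word w" "1 \<in> borders w" "p \<le> card (borders w)"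
    "12 * length w \<le> 17 * 4 ^ (p - 1) + 4"
    using exists_squarefree_word_with_many_borders[OF assms(2)] by blast
  have "w \<noteq> []"
    using w(2) by (auto simp: borders_def)
  \<comment> \<open>Passing to a prefix turns at least \<open>p\<close> borders into exactly
    \<open>p\<close> without increasing the length.\<close>
  then obtain v where v: "prefix v w" "v \<noteq> []" "card (borders v) = p"
    using exists_prefix_with_card_borders[OF w(3)] by blast
  have "card (UNIV :: letter set) = card A" "finite (UNIV :: letter set)" "finite A"
    using assms(1) by (simp_all add: letter_UNIV card_ge_0_finite)
  then obtain f :: "letter \<Rightarrow> 'a" where "bij_betw f UNIV A"
    using finite_same_card_bij by blast
  then have f: "inj f" "range f = A"
    by (auto simp: bij_betw_def)
  have "squarefree_word v"
    using squarefree_word_sublist w(1) v(1) by blast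
  \<comment> \<open>This membership gives both the nonemptiness claim and the upper bound on the
    least length.\<close>
  then have mem: "map f v \<in> squarefree_words_with_periods A p"
    using v f by (auto simp: squarefree_words_with_periods_def card_nontrivial_periods
        borders_map_inj squarefree_word_map_inj)
  then have "g A p \<le> length (map f v)"
    unfolding g_def by (intro Least_le) blast
  also have "\<dots> \<le> length w"
    using v(1) by (simp add: prefix_length_le)
  finally have "12 * g A p \<le> 17 * 4 ^ (p - 1) + 4"
    using w(4) by linarith
  then have "real (12 * g A p) \<le> real (17 * 4 ^ (p - 1) + 4)"
    by (rule of_nat_mono)
  then show ?thesis
    using mem by auto
qed

end
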